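(* Let $n=2^t p$, where $t$ is a positive integer and $p$ is an odd prime, and let $P_n$ be the path on vertices $1,\ldots,n$ (consecutive labels adjacent). Let $1\le a\le n-1$ be an integer. Then $P_n$ has Laplacian pretty good edge state transfer from $\{a,a+1\}$ to $\{n-a,n-a+1\}$ if and only if $a$ is a multiple of $2^{t-1}$.
   Context: For a graph $G$ with Laplacian $L_G=D_G-A_G$ and $U(t)=\exp(-\mathrm{i}tL_G)$, $G$ has Laplacian pretty good edge state transfer (Edge-LPGST) from the edge $\{a,b\}$ to the edge $\{c,d\}$ if for every $\epsilon>0$ there exist $\tau\in\mathbb{R}$ and $\gamma\in\mathbb{C}$ with $|\gamma|=1$ such that $\left|U(\tau)(\mathbf{e}_a-\mathbf{e}_b)-\gamma(\mathbf{e}_c-\mathbf{e}_d)\right|<\epsilon$, where $\mathbf{e}_u$ is the standard unit vector at vertex $u$. *)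

theory Defs
  imports
    "HOL-Analysis.L2_Norm"
    "HOL-Computational_Algebra.Primes"
    "Jordan_Normal_Form.Jordan_Normal_Form"
begin

text \<open>A graph is given by its number \<open>n\<close> of vertices and its edge set; the vertices are
  \<open>1, \<dots>, n\<close>. Rows and columns of matrices are indexed from 0, so vertex \<open>u\<close> has index \<open>u - 1\<close>.\<close>

definition simple_graph :: "nat \<Rightarrow> nat set set \<Rightarrow> bool" where
  "simple_graph n E \<longleftrightarrow> (\<forall>e\<in>E. e \<subseteq> {1..n} \<and> card e = 2)"

definition path_edges :: "nat \<Rightarrow> nat set set" where
  "path_edges n = {{i, i + 1} | i. 1 \<le> i \<and> i + 1 \<le> n}"

lemma simple_graph_path_edges: "simple_graph n (path_edges n)"
  by (auto simp: simple_graph_def path_edges_def)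

definition adjacency_mat :: "nat \<Rightarrow> nat set set \<Rightarrow> complex mat" where
  "adjacency_mat n E = mat n n (\<lambda>(i, j). if {i + 1, j + 1} \<in> E then 1 else 0)"

definition degree_mat :: "nat \<Rightarrow> nat set set \<Rightarrow> complex mat" where
  "degree_mat n E = mat n n (\<lambda>(i, j). if i = j then of_nat (card {e \<in> E. i + 1 \<in> e}) else 0)"

definition laplacian_mat :: "nat \<Rightarrow> nat set set \<Rightarrow> complex mat" where
  "laplacian_mat n E = degree_mat n E - adjacency_mat n E"

text \<open>The exponential of a square matrix, as the entrywise sum of the power series. The series
  always converges, see \<open>summable_exp_mat\<close>.\<close>

definition exp_mat :: "complex mat \<Rightarrow> complex mat" where
  "exp_mat A = mat (dim_row A) (dim_row A) (\<lambda>(i, j). \<Sum>k. (A ^\<^sub>m k) $$ (i, j) / fact k)"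

lemma summable_exp_mat:
  assumes A: "A \<in> carrier_mat n n" and "i < n" "j < n"
  shows "summable (\<lambda>k. (A ^\<^sub>m k) $$ (i, j) / fact k :: complex)"
proof -
  obtain c where c: "norm_bound A c"
    using norm_bound_max by blast
  have pow: "norm_bound (A ^\<^sub>m k) ((c * real n) ^ k)" for k
  proof (induction k)
    case 0
    show ?case using A by (auto simp: norm_bound_def)
  next
    case (Suc k)
    have "A ^\<^sub>m k \<in> carrier_mat n n" using A by simp
    from norm_bound_mult[OF this A Suc c] show ?case by (simp add: mult_ac)
  qed
  show ?thesis
  proof (rule summable_comparison_test', rule summable_exp)
    fix k :: nat
    have "norm ((A ^\<^sub>m k) $$ (i, j)) \<le> (c * real n) ^ k"
      using pow[of k] A assms(2,3) by (auto simp: norm_bound_def)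
    then show "norm ((A ^\<^sub>m k) $$ (i, j) / fact k) \<le> inverse (fact k) * (c * real n) ^ k"
      by (simp add: norm_divide field_simps)
  qed
qed

definition transition_mat :: "nat \<Rightarrow> nat set set \<Rightarrow> real \<Rightarrow> complex mat" where
  "transition_mat n E t = exp_mat ((- \<i> * complex_of_real t) \<cdot>\<^sub>m laplacian_mat n E)"

definition vertex_vec :: "nat \<Rightarrow> nat \<Rightarrow> complex vec" where
  "vertex_vec n u = unit_vec n (u - 1)"

definition euclidean_norm :: "complex vec \<Rightarrow> real" where
  "euclidean_norm v = L2_set (\<lambda>i. cmod (v $ i)) {..<dim_vec v}"

definition edge_LPGST :: "nat \<Rightarrow> nat set set \<Rightarrow> nat \<Rightarrow> nat \<Rightarrow> nat \<Rightarrow> nat \<Rightarrow> bool" where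
  "edge_LPGST n E a b c d \<longleftrightarrow>
     {a, b} \<in> E \<and> {c, d} \<in> E \<and>
     (\<forall>\<epsilon>>0. \<exists>\<tau>::real. \<exists>\<gamma>::complex. cmod \<gamma> = 1 \<and>
        euclidean_norm (transition_mat n E \<tau> *\<^sub>v (vertex_vec n a - vertex_vec n b)
          - \<gamma> \<cdot>\<^sub>v (vertex_vec n c - vertex_vec n d)) < \<epsilon>)"

end

theory Submission
  imports
    "HOL-Number_Theory.Residues"
    "HOL-Analysis.Kronecker_Approximation_Theorem"
    Defs
begin

text \<open>The vectors \<open>v\<^sub>j(u) = cos (\<pi> j (2u - 1) / 2n)\<close> diagonalise the Laplacian of the path, with
  eigenvalues \<open>2 - x\<^sub>j\<close>, \<open>x\<^sub>j = 2 cos (\<pi> j / n)\<close>. Comparing coefficients, transfer holds iff for suitable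
  \<open>\<tau>\<close> and \<open>\<phi>\<close> the numbers \<open>cis (\<tau> x\<^sub>j - \<phi>)\<close> simultaneously approximate \<open>(-1)^j\<close> for all \<open>j\<close> with
  \<open>n \<nmid> j a\<close>. Everything is governed by the relations
  \<open>\<Sum>m<p. (-1)^m x\<^sub>k = 0\<close>, \<open>k = j + 2^t m\<close>, between the eigenvalues.

  If \<open>2^(t-1)\<close> does not divide \<open>a\<close>, every \<open>j\<close> not divisible by 4 is constrained, and the relations for
  \<open>j = 1\<close> and \<open>j = 2\<close> force \<open>cis (- \<phi>)\<close> to be close to both \<open>-1\<close> and \<open>1\<close>.

  Otherwise only indices not divisible by \<open>2p\<close> are constrained. By irreducibility of the cyclotomic
  polynomial of order \<open>2n\<close>, the numbers \<open>x\<^sub>1, \<dots>, x\<^sub>d\<close> with \<open>2d = totient (2n)\<close> are linearly independent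
  over the integers, so Kronecker's theorem prescribes their phases freely; the relations then
  propagate the phases to all \<open>j\<close>.\<close>

section \<open>Irreducibility of cyclotomic polynomials\<close>

abbreviation ipoly :: "int poly \<Rightarrow> complex \<Rightarrow> complex" where
  "ipoly f z \<equiv> poly (of_int_poly f) z"

text \<open>A substitute for minimal polynomials over the rationals. A nonzero integer polynomial
  \<open>h\<close> of least degree vanishing at \<open>z\<close> divides every other such polynomial
  up to a constant factor. Primality lets \<open>f\<close> pass through these products, and the
  constants are harmless because \<open>f\<close>, having a root, divides no nonzero
  constant.\<close>

lemma ipoly_prime_elem_dvd:
  assumes f: "prime_elem f" "ipoly f z = 0" and g: "ipoly g z = 0"
  shows "f dvd g"
proof -
  have f0: "f \<noteq> 0" using f by auto
  define P where "P h \<longleftrightarrow> h \<noteq> 0 \<and> ipoly h z = 0" for h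
  obtain h where h: "P h" and hmin: "\<And>h'. P h' \<Longrightarrow> degree h \<le> degree h'"
    using ex_has_least_nat[of P f degree] f f0 unfolding P_def by auto
  have deg_h: "degree h > 0"
  proof (rule ccontr)
    assume "\<not> degree h > 0"
    then obtain c where "h = [:c:]" by (metis degree_eq_zeroE gr0I)
    then show False using h by (auto simp: P_def)
  qed
  \<comment> \<open>Integer polynomials admit only pseudo-division. The remainder vanishes at
    \<open>z\<close>, so it is zero by minimality of \<open>h\<close>.\<close>
  have red: "\<exists>c q. c \<noteq> 0 \<and> smult c k = h * q" if "ipoly k z = 0" for k
  proof -
    have h0: "h \<noteq> 0" using h by (simp add: P_def)
    obtain c q where c: "c \<noteq> 0" "smult c k = h * q + pseudo_mod k h"
      using pseudo_mod(1)[OF h0, of k] by auto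
    have "ipoly (smult c k) z = ipoly (h * q + pseudo_mod k h) z" using c by simp
    then have "ipoly (pseudo_mod k h) z = 0"
      using that h by (simp add: P_def hom_distribs)
    then have "pseudo_mod k h = 0"
      using hmin[of "pseudo_mod k h"] pseudo_mod(2)[OF h0, of k] by (force simp: P_def)
    then show ?thesis using c by auto
  qed
  have f_dvd_cancel: "f dvd k" if "f dvd smult c k" "c \<noteq> 0" for c k
  proof -
    have "f dvd [:c:] * k" using that by simp
    then have "f dvd [:c:] \<or> f dvd k" using f(1) prime_elem_dvd_mult_iff by blast
    moreover have "\<not> f dvd [:c:]"
    proof
      assume "f dvd [:c:]"
      then obtain k where "[:c:] = f * k" by (elim dvdE)
      then have "ipoly [:c:] z = ipoly f z * ipoly k z" by (metis of_int_poly_hom.hom_mult poly_mult)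
      then show False using f that by simp
    qed
    ultimately show ?thesis by blast
  qed
  obtain c q where c: "c \<noteq> 0" "smult c f = h * q" using red f by blast
  have "f dvd h"
  proof -
    have "f dvd h * q" using c by (metis dvd_smult dvd_refl)
    then have "f dvd h \<or> f dvd q" using f by (simp add: prime_elem_dvd_mult_iff)
    \<comment> \<open>If \<open>f\<close> divided \<open>q\<close>, cancelling \<open>f\<close> in
      \<open>smult c f = h * q\<close> would make \<open>h\<close> a divisor of a nonzero
      constant.\<close>
    moreover have "\<not> f dvd q"
    proof
      assume "f dvd q"
      then obtain v where v: "q = f * v" by (elim dvdE)
      have "f * (h * v) = f * [:c:]" using c v by (simp add: mult_ac)
      then have "h * v = [:c:]" using f0 by (simp only: mult_cancel_left) simp
      then have "degree h = 0" using \<open>c \<noteq> 0\<close>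
        by (metis add_is_0 degree_mult_eq degree_pCons_0 mult_eq_0_iff pCons_eq_0_iff)
      then show False using deg_h by simp
    qed
    ultimately show ?thesis by blast
  qed
  moreover obtain c' q' where "c' \<noteq> 0" "smult c' g = h * q'" using red g by blast
  ultimately show ?thesis using f_dvd_cancel[of c' g] by (metis dvd_mult2)
qed

text \<open>Modulo \<open>q\<close>, taking \<open>q\<close>-th powers is additive because the inner
  binomial coefficients vanish, and it fixes constants by Fermat's little theorem. The induction
  splits off the constant coefficient.\<close>

lemma int_poly_frobenius:
  fixes f :: "int poly"
  assumes q: "prime (q::nat)"
  shows "[:int q:] dvd f ^ q - pcompose f (monom 1 q)"
proof (induction f)
  case 0
  then show ?case using q prime_gt_0_nat by (simp add: zero_power)
next
  case (pCons a f)
  have add: "[:int q:] dvd (u + v) ^ q - (u ^ q + v ^ q)" for u v :: "int poly"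
  proof -
    have q1: "q \<ge> 1" using q prime_ge_1_nat by blast
    have "(u + v) ^ q = (\<Sum>k\<le>q. of_nat (q choose k) * u ^ k * v ^ (q - k))"
      by (rule binomial_ring)
    also have "\<dots> = (\<Sum>k\<in>{0,q}. of_nat (q choose k) * u ^ k * v ^ (q - k))
        + (\<Sum>k\<in>{..q}-{0,q}. of_nat (q choose k) * u ^ k * v ^ (q - k))"
      by (subst sum.union_disjoint[symmetric]) (auto intro!: sum.cong)
    also have "(\<Sum>k\<in>{0,q}. of_nat (q choose k) * u ^ k * v ^ (q - k)) = u ^ q + v ^ q"
      using q1 by (simp add: add.commute)
    finally have "(u + v) ^ q - (u ^ q + v ^ q)
      = (\<Sum>k\<in>{..q}-{0,q}. of_nat (q choose k) * u ^ k * v ^ (q - k))" by simp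
    also have "[:int q:] dvd \<dots>"
    proof (rule dvd_sum)
      fix k assume "k \<in> {..q} - {0, q}"
      then have "q dvd (q choose k)" using q by (intro dvd_choose_prime) auto
      then obtain m where "q choose k = q * m" by (elim dvdE)
      then have "(of_nat (q choose k) :: int poly) = [:int q:] * of_nat m"
        by (simp add: of_nat_poly)
      then show "[:int q:] dvd of_nat (q choose k) * u ^ k * v ^ (q - k)"
        by (metis dvd_mult2 dvd_triv_left)
    qed
    finally show ?thesis .
  qed
  have const: "[:int q:] dvd [:a:] ^ q - [:a:]"
  proof -
    have "[a ^ q = a] (mod int q)"
    proof (cases "int q dvd a")
      case True
      then show ?thesis using q prime_gt_0_nat
        by (metis cong_0_iff cong_sym cong_trans dvd_power dvd_trans)
    next
      case False
      have "coprime a (int q)"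
        using False q by (metis coprime_commute prime_imp_coprime prime_nat_int_transfer)
      then have "[a ^ totient q = 1] (mod int q)"
        using residues.euler_theorem[of "int q" a] q prime_gt_1_nat[of q] by (simp add: residues_def)
      then have "[a ^ (q - 1) = 1] (mod int q)"
        using q by (simp add: totient_prime)
      then have "[a ^ (q - 1) * a = 1 * a] (mod int q)" by (rule cong_scalar_right)
      then show ?thesis using q prime_gt_0_nat[of q]
        by (metis mult_1 power_minus_mult)
    qed
    then have "int q dvd a ^ q - a" by (simp add: cong_iff_dvd_diff)
    then have "[:int q:] dvd [:a ^ q - a:]" by (simp add: const_poly_dvd)
    moreover have "[:a:] ^ q - [:a:] = [:a ^ q - a:]" by (simp add: poly_const_pow)
    ultimately show ?thesis by simp
  qed
  define A B where "A = [:a:]" and "B = [:0, 1:] * f"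
  have "B ^ q = monom 1 q * f ^ q"
    unfolding B_def power_mult_distrib by (simp only: monom_altdef smult_1_left)
  moreover have "pCons a f = A + B" by (simp add: A_def B_def)
  moreover have "pcompose (pCons a f) (monom 1 q) = A + monom 1 q * pcompose f (monom 1 q)"
    by (simp add: pcompose_pCons A_def)
  ultimately have "pCons a f ^ q - pcompose (pCons a f) (monom 1 q)
     = ((A + B) ^ q - (A ^ q + B ^ q)) + (A ^ q - A)
       + monom 1 q * (f ^ q - pcompose f (monom 1 q))"
    by (simp add: algebra_simps)
  then show ?case using add const pCons(2) by (simp only: A_def dvd_add dvd_mult)
qed

text \<open>Dedekind's argument: if \<open>z ^ q\<close> were not a root of \<open>f\<close>, it
  would be a root of the cofactor \<open>h\<close> of \<open>f\<close> in \<open>X^N - 1\<close>,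
  which conflicts with \<open>X^N - 1\<close> having no repeated factor modulo a prime not dividing
  \<open>N\<close>.\<close>

lemma ipoly_root_power_prime:
  assumes N: "N > 0" "z ^ N = 1" and f: "prime_elem f" "ipoly f z = 0"
    and q: "prime (q::nat)" "\<not> q dvd N"
  shows "ipoly f (z ^ q) = 0"
proof (rule ccontr)
  assume nz: "ipoly f (z ^ q) \<noteq> 0"
  have zq: "(z ^ q) ^ N = 1"
    using N by (metis power_commutes power_mult power_one mult.commute)
  have "ipoly (monom 1 N - 1) z = 0" using N by (simp add: hom_distribs poly_monom)
  then have "f dvd monom 1 N - 1" using f ipoly_prime_elem_dvd by blast
  then obtain h where h: "monom 1 N - 1 = f * h" by (elim dvdE)
  have "ipoly f (z ^ q) * ipoly h (z ^ q) = ipoly (monom 1 N - 1) (z ^ q)"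
    by (simp add: h hom_distribs)
  also have "\<dots> = 0" using zq by (simp add: hom_distribs poly_monom)
  finally have hz: "ipoly h (z ^ q) = 0" using nz by simp
  txt \<open>Differentiating \<open>X^N - 1 = f h\<close> at \<open>z^q\<close> exhibits \<open>f(z^q)\<close>, which is divisible by \<open>q\<close> by
    Frobenius, as a divisor of \<open>N\<close>.\<close>
  have "pderiv (monom 1 N - 1) = pderiv (f * h)" using h by simp
  then have "monom (int N) (N - 1) = f * pderiv h + h * pderiv f"
    by (simp add: pderiv_diff pderiv_monom pderiv_mult algebra_simps)
  then have "ipoly (monom (int N) (N - 1)) (z ^ q) = ipoly (f * pderiv h + h * pderiv f) (z ^ q)"
    by simp
  then have 1: "of_nat N * (z ^ q) ^ (N - 1) = ipoly f (z ^ q) * ipoly (pderiv h) (z ^ q)"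
    by (simp add: hom_distribs poly_monom hz)
  obtain g where g: "f ^ q - pcompose f (monom 1 q) = [:int q:] * g"
    using int_poly_frobenius[OF q(1), of f] by (elim dvdE)
  have "ipoly f z ^ q - ipoly f (z ^ q) = ipoly (f ^ q - pcompose f (monom 1 q)) z"
    by (simp only: hom_distribs poly_diff poly_power poly_pcompose) (simp add: poly_monom)
  also have "\<dots> = of_nat q * ipoly g z" by (simp add: g hom_distribs)
  finally have 2: "ipoly f (z ^ q) = - of_nat q * ipoly g z"
    using f q(1) prime_gt_0_nat[of q] by (metis (no_types) diff_0 minus_minus minus_mult_left zero_power)
  \<comment> \<open>The factor \<open>monom 1 q\<close> supplies the missing \<open>z ^ q\<close>
    that completes \<open>(z ^ q) ^ (N - 1)\<close> to 1; thus \<open>q\<close> times the value of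
    \<open>u\<close> at \<open>z\<close> is \<open>N\<close>.\<close>
  define u where "u = - g * pcompose (pderiv h) (monom 1 q) * monom 1 q"
  have "ipoly u z = - ipoly g z * ipoly (pderiv h) (z ^ q) * z ^ q"
    by (simp only: u_def hom_distribs poly_mult poly_minus poly_pcompose) (simp add: poly_monom)
  then have "of_nat q * ipoly u z = (- of_nat q * ipoly g z) * ipoly (pderiv h) (z ^ q) * z ^ q"
    by simp
  also have "\<dots> = of_nat N * ((z ^ q) ^ (N - 1) * z ^ q)" by (metis 1 2 mult.assoc)
  also have "(z ^ q) ^ (N - 1) * z ^ q = 1" using zq power_minus_mult[OF N(1), of "z ^ q"] by simp
  finally have u: "ipoly ([:int q:] * u - [:int N:]) z = 0" by (simp add: hom_distribs)
  \<comment> \<open>A divisor of the monic \<open>X^N - 1\<close> has a unit as leading coefficient,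
    so pseudo-division by \<open>f\<close> scales only by a unit.\<close>
  obtain c where c: "is_unit c" "lead_coeff f = c"
  proof -
    have "lead_coeff (monom 1 N - 1 :: int poly) = 1"
    proof -
      have "degree (monom 1 N + (- 1) :: int poly) = N"
        using N by (subst degree_add_eq_left) (simp_all add: degree_monom_eq)
      then show ?thesis using N by (simp add: coeff_eq_0)
    qed
    then have "lead_coeff f * lead_coeff h = 1" by (simp add: h lead_coeff_mult)
    then have "is_unit (lead_coeff f)" by (metis dvd_triv_left)
    then show ?thesis using that by blast
  qed
  obtain v w where "pseudo_divmod u f = (v, w)" by fastforce
  from pseudo_divmod[OF _ this] f c
  obtain e where e: "smult (c ^ e) u = f * v + w" and w: "w = 0 \<or> degree w < degree f"
    by auto
  have "ipoly w z = of_int (c ^ e) * ipoly u z"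
    using arg_cong[OF e, of "\<lambda>p. ipoly p z"] f by (simp add: hom_distribs)
  moreover have "of_nat q * ipoly u z = of_nat N" using u by (simp add: hom_distribs)
  ultimately have "ipoly ([:int q:] * w - [:c ^ e * int N:]) z = 0"
    by (simp add: hom_distribs)
  \<comment> \<open>This multiple of \<open>f\<close> has smaller degree than \<open>f\<close>, so
    it is zero, and its constant coefficient exhibits \<open>q\<close> as a divisor of
    \<open>N\<close>.\<close>
  then have "f dvd [:int q:] * w - [:c ^ e * int N:]" (is "f dvd ?r")
    using f ipoly_prime_elem_dvd by blast
  have degf: "degree f > 0"
  proof (rule ccontr)
    assume "\<not> degree f > 0"
    then obtain b where b: "f = [:b:]" by (metis degree_eq_zeroE gr0I)
    then have "b = 0" using f(2) by (simp add: hom_distribs)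
    then show False using f(1) b by (simp add: prime_elem_def)
  qed
  have "degree ?r < degree f"
    using w degf by (intro degree_diff_less) auto
  then have "?r = 0" using \<open>f dvd ?r\<close> by (meson dvd_imp_degree_le not_less)
  then have "coeff ?r 0 = 0" by simp
  then have "int q * coeff w 0 = c ^ e * int N" by simp
  then have "int q dvd c ^ e * int N" by (metis dvd_triv_left)
  then have "int q dvd int N" using c
    by (meson dvd_mult_unit_iff' is_unit_power_iff dvd_trans unit_imp_dvd zdvd_mult_cancel)
  then show False using q by simp
qed

text \<open>Prime factors of \<open>m\<close> are stripped one at a time. The root stays arbitrary
  in the induction because each step replaces \<open>z\<close> by \<open>z ^ q\<close>.\<close>

lemma ipoly_root_power:
  assumes N: "N > 0" and f: "prime_elem f" and "z ^ N = 1" "ipoly f z = 0" "m > 0" "coprime m N"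
  shows "ipoly f (z ^ m) = 0"
  using assms(3-)
proof (induction m arbitrary: z rule: less_induct)
  case (less m)
  show ?case
  proof (cases "m = 1")
    case False
    then obtain q where q: "prime q" "q dvd m" using prime_factor_nat by blast
    then obtain m' where m': "m = q * m'" by (elim dvdE)
    have "\<not> q dvd N" using q less.prems m' by (meson coprime_common_divisor not_prime_unit)
    then have 1: "ipoly f (z ^ q) = 0" using ipoly_root_power_prime N f less.prems q by blast
    have "m' > 0" "m' < m" using less.prems q m' prime_gt_1_nat by (auto intro: Nat.gr0I)
    moreover have "(z ^ q) ^ N = 1" using less.prems
      by (metis power_commutes power_mult power_one mult.commute)
    moreover have "coprime m' N" using less.prems m' by simp
    ultimately have "ipoly f ((z ^ q) ^ m') = 0" using less.IH 1 by blast
    then show ?thesis by (simp add: m' power_mult)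
  qed (use less in simp)
qed

text \<open>Some prime factor of \<open>g\<close> vanishes at the given primitive root of unity,
  hence at all its powers with exponent coprime to \<open>N\<close>. These are
  \<open>totient N\<close> distinct roots.\<close>

lemma totient_le_degree_ipoly_root:
  assumes N: "N > 0" and g: "g \<noteq> 0" "ipoly g (cis (2 * pi / real N)) = 0"
  shows "totient N \<le> degree g"
proof -
  define z where "z = cis (2 * pi / real N)"
  have zN: "z ^ N = 1" using N by (simp add: z_def Complex.DeMoivre)
  have "\<exists>f. prime_elem f \<and> ipoly f z = 0"
  proof -
    have "\<exists>p\<in>#A. ipoly p z = 0" if "ipoly (prod_mset A) z = 0" for A
      using that by (induction A) (auto simp: hom_distribs)
    moreover have "ipoly (prod_mset (prime_factorization g)) z = 0"
    proof -
      have "g dvd prod_mset (prime_factorization g)"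
        using prod_mset_prime_factorization_weak[OF g(1)] by (metis dvd_refl normalize_dvd_iff dvd_normalize_iff)
      then obtain k where "prod_mset (prime_factorization g) = g * k" by (elim dvdE)
      then show ?thesis using g(2) by (simp add: z_def hom_distribs)
    qed
    ultimately obtain p where "p \<in># prime_factorization g" "ipoly p z = 0" by blast
    then show ?thesis using in_prime_factors_imp_prime prime_imp_prime_elem by blast
  qed
  then obtain f where f: "prime_elem f" "ipoly f z = 0" by blast
  have "f dvd g" using ipoly_prime_elem_dvd f g z_def by simp
  then have deg: "degree f \<le> degree g" using g by (simp add: dvd_imp_degree_le)
  have f0: "of_int_poly f \<noteq> (0 :: complex poly)" using f by auto
  \<comment> \<open>For \<open>N = 1\<close> the only totative is 1, which lies outside
    \<open>{..<N}\<close>; hence the separate case.\<close>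
  have inj: "inj_on (\<lambda>m. z ^ m) (totatives N)"
  proof (cases "N = 1")
    case False
    have "inj_on (\<lambda>m. z ^ m) {..<N}"
    proof -
      have "(\<lambda>m. z ^ m) = (\<lambda>m. cis (2 * pi * real m / real N))"
        by (auto simp: z_def Complex.DeMoivre mult_ac)
      then show ?thesis
        using Complex.bij_betw_roots_unity[of N] N by (simp add: bij_betw_def)
    qed
    moreover have "totatives N \<subseteq> {..<N}"
      using False N totatives_less by auto
    ultimately show ?thesis using inj_on_subset by blast
  qed simp
  have "(\<lambda>m. z ^ m) ` totatives N \<subseteq> {x. ipoly f x = 0}"
    using ipoly_root_power[OF N f(1) zN f(2)] by (auto simp: totatives_def)
  then have "card ((\<lambda>m. z ^ m) ` totatives N) \<le> card {x. ipoly f x = 0}"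
    using poly_roots_finite[OF f0] card_mono by blast
  also have "\<dots> \<le> degree (of_int_poly f :: complex poly)" using f0 poly_roots_degree by blast
  finally show ?thesis using deg by (simp add: card_image[OF inj] totient_def)
qed

section \<open>Linear independence of cosines\<close>

text \<open>Up to a common factor the terms are the powers of \<open>r\<close>, a
  \<open>p\<close>-th root of unity because \<open>p\<close> is odd, and different from 1 because
  \<open>p > 1\<close>.\<close>

lemma alternating_cis_sum:
  fixes x :: real
  assumes "odd p" "p > 1" "M > 0"
  shows "(\<Sum>m<p. (-1) ^ m * cis (pi * (x + real (M * m)) / real (M * p))) = 0"
proof -
  define r where "r = - cis (pi / real p)"
  have "r ^ p = 1"
    using assms by (simp add: r_def Complex.DeMoivre power_minus_odd)
  moreover have "r \<noteq> 1"
  proof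
    assume "r = 1"
    then have "sin (pi / real p) = 0" by (simp add: r_def complex_eq_iff)
    moreover have "sin (pi / real p) > 0"
      using assms by (intro sin_gt_zero) (simp_all add: field_simps)
    ultimately show False by simp
  qed
  ultimately have sum0: "(\<Sum>m<p. r ^ m) = 0" by (simp add: sum_gp_strict)
  have "(-1) ^ m * cis (pi * (x + real (M * m)) / real (M * p))
      = cis (pi * x / real (M * p)) * r ^ m" for m
  proof -
    have "pi * (x + real (M * m)) / real (M * p) = pi * x / real (M * p) + real m * (pi / real p)"
      using assms by (simp add: field_simps)
    moreover have "r ^ m = (-1) ^ m * cis (real m * (pi / real p))"
      by (simp add: r_def power_minus[of "cis _"] Complex.DeMoivre)
    ultimately show ?thesis by (simp only: cis_mult[symmetric]) simp
  qed
  then show ?thesis using sum0 by (simp flip: sum_distrib_left)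
qed

lemma alternating_cos_sum:
  fixes x :: real
  assumes "odd p" "p > 1" "M > 0"
  shows "(\<Sum>m<p. (-1) ^ m * cos (pi * (x + real (M * m)) / real (M * p))) = 0"
proof -
  have 1: "(-1) ^ m * cos y = Re ((-1) ^ m * cis y)" for m y by (cases "even m") auto
  show ?thesis unfolding 1 Re_sum[symmetric] alternating_cis_sum[OF assms] by simp
qed

text \<open>With \<open>2 * cos\<close> written as a sum of two inverse powers of \<open>z\<close>
  and everything multiplied by \<open>z ^ d\<close>, a relation becomes a palindromic polynomial
  \<open>g\<close> of degree at most \<open>2 * d\<close> with root \<open>z\<close>. The degree
  bound leaves only constant multiples of \<open>\<Phi>\<close>, and the middle coefficient, zero in
  \<open>g\<close> but not in \<open>\<Phi>\<close>, excludes the nonzero ones.\<close>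

lemma cos_linear_independent:
  fixes c :: "nat \<Rightarrow> int"
  assumes t: "t \<ge> 1" and p: "prime p" "odd p"
    and n: "n = 2 ^ t * p" and d: "d = 2 ^ (t - 1) * (p - 1)"
    and sum0: "(\<Sum>j=1..d. real_of_int (c j) * (2 * cos (pi * real j / real n))) = 0"
    and j: "j \<in> {1..d}"
  shows "c j = 0"
proof -
  have p1: "p > 1" using p prime_gt_1_nat by blast
  obtain h where h: "p = 2 * h + 1" using p by (elim oddE)
  have dh: "d = 2 ^ t * h" using t by (simp add: d h power_eq_if)
  have n0: "n > 0" using p1 n by simp
  define z where "z = cis (pi / real n)"
  have zpow: "z ^ k = cis (pi * real k / real n)" for k
    by (simp add: z_def Complex.DeMoivre mult_ac)
  define g where "g = (\<Sum>j=1..d. monom (c j) (d + j) + monom (c j) (d - j))"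
  \<comment> \<open>This is the cyclotomic polynomial of order \<open>2 * n\<close>, of degree
    \<open>2 * d\<close>; its middle exponent is \<open>d = 2 ^ t * h\<close>.\<close>
  define \<Phi> where "\<Phi> = (\<Sum>m<p. monom ((-1) ^ m :: int) (2 ^ t * m))"
  have "ipoly g z = (\<Sum>j=1..d. of_int (c j) * (z ^ (d + j) + z ^ (d - j)))"
    by (simp add: g_def hom_distribs poly_sum poly_monom algebra_simps)
  also have "\<dots> = (\<Sum>j=1..d. z ^ d * of_real (real_of_int (c j) * (2 * cos (pi * real j / real n))))"
  proof (rule sum.cong)
    fix j assume "j \<in> {1..d}"
    then have "z ^ (d - j) = z ^ d * cis (- (pi * real j / real n))"
      by (simp add: zpow cis_mult of_nat_diff algebra_simps diff_divide_distrib)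
    moreover have "z ^ (d + j) = z ^ d * cis (pi * real j / real n)"
      by (simp add: power_add zpow)
    moreover have "cis y + cis (- y) = of_real (2 * cos y)" for y
      by (simp add: complex_eq_iff)
    ultimately show "of_int (c j) * (z ^ (d + j) + z ^ (d - j))
        = z ^ d * of_real (real_of_int (c j) * (2 * cos (pi * real j / real n)))"
      by (simp only: distrib_left[symmetric]) simp
  qed simp
  also have "\<dots> = 0"
    unfolding sum_distrib_left[symmetric] of_real_sum[symmetric] sum0 by simp
  finally have g0: "ipoly g z = 0" .
  have "ipoly \<Phi> z = (\<Sum>m<p. (-1) ^ m * cis (pi * (0 + real (2 ^ t * m)) / real (2 ^ t * p)))"
    by (simp add: \<Phi>_def hom_distribs poly_sum poly_monom zpow n)
  also have "\<dots> = 0" using alternating_cis_sum[of p "2 ^ t" 0] p p1 by simp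
  finally have \<Phi>0: "ipoly \<Phi> z = 0" .
  have coeff_g: "coeff g i = (\<Sum>j=1..d. (if d + j = i then c j else 0) + (if d - j = i then c j else 0))" for i
    by (simp add: g_def coeff_sum)
  have coeff_\<Phi>: "coeff \<Phi> i = (\<Sum>m<p. if 2 ^ t * m = i then (-1) ^ m else 0)" for i
    by (simp add: \<Phi>_def coeff_sum)
  have g_hi: "coeff g (d + j) = c j" if "j \<in> {1..d}" for j
  proof -
    have "coeff g (d + j) = (\<Sum>i=1..d. if i = j then c i else 0)"
      unfolding coeff_g using that by (intro sum.cong) auto
    then show ?thesis using that by simp
  qed
  have g_mid: "coeff g d = 0" unfolding coeff_g by (intro sum.neutral) auto
  have g_out: "coeff g i = 0" if "i > 2 * d" for i
    unfolding coeff_g using that by (intro sum.neutral) auto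
  have \<Phi>_at: "coeff \<Phi> (2 ^ t * m) = (-1) ^ m" if "m < p" for m
  proof -
    have "coeff \<Phi> (2 ^ t * m) = (\<Sum>k<p. if k = m then (-1) ^ k else 0)"
      unfolding coeff_\<Phi> by (intro sum.cong) auto
    then show ?thesis using that by simp
  qed
  have \<Phi>_out: "coeff \<Phi> i = 0" if "i > 2 * d" for i
    unfolding coeff_\<Phi> using that by (intro sum.neutral) (auto simp: dh h)
  have \<Phi>_top: "coeff \<Phi> (2 * d) = 1"
    using \<Phi>_at[of "2 * h"] by (simp add: dh h mult_ac)
  have "h > 0" using p1 h by simp
  then have "d > 0" by (simp add: dh)
  txt \<open>\<open>g\<close> may have degree \<open>2 d = totient (2 n)\<close>, so its top coefficient is first removed using the
    cyclotomic polynomial \<open>\<Phi>\<close>; the middle coefficients then show \<open>c d = 0\<close>.\<close>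
  define k where "k = g - smult (c d) \<Phi>"
  have "k = 0"
  proof (rule ccontr)
    assume k0: "k \<noteq> 0"
    have "ipoly k z = 0" using g0 \<Phi>0 by (simp add: k_def hom_distribs)
    then have "totient (2 * n) \<le> degree k"
      using totient_le_degree_ipoly_root[of "2 * n" k] k0 n0 by (simp add: z_def)
    moreover have "totient (2 * n) = 2 * d"
    proof -
      have "2 * n = 2 ^ Suc t * p" by (simp add: n)
      moreover have "coprime (2 ^ Suc t) p" using p by simp
      ultimately have "totient (2 * n) = totient (2 ^ Suc t) * totient p"
        by (metis totient_mult_coprime)
      also have "totient (2 ^ Suc t) = 2 ^ t" using totient_prime_power[of 2 "Suc t"] by simp
      also have "totient p = p - 1" using p by (simp add: totient_prime)
      finally show ?thesis using t by (cases t) (simp_all add: d)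
    qed
    ultimately have "degree k \<ge> 2 * d" by simp
    moreover have "coeff k i = 0" if "i \<ge> 2 * d" for i
      using that g_hi[of d] \<open>d > 0\<close> \<Phi>_top g_out[of i] \<Phi>_out[of i]
      by (cases "i = 2 * d") (auto simp: k_def mult_2)
    ultimately show False using k0 by (metis leading_coeff_neq_0)
  qed
  then have "coeff k d = 0" by simp
  then have "c d = 0" using g_mid \<Phi>_at[of h] by (simp add: k_def dh h)
  then have "g = 0" using \<open>k = 0\<close> by (simp add: k_def)
  then show ?thesis using g_hi[OF j] by simp
qed

section \<open>Simultaneous approximation of phases\<close>

text \<open>Kronecker's theorem is applied with tolerance \<open>1 / Suc k\<close> for every
  \<open>k\<close>; the limit form makes later products and conjugates of phases easy to handle.
  After scaling by \<open>2 * pi\<close> the integer parts \<open>h\<close> disappear under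
  \<open>cis\<close>.\<close>

lemma Kronecker_sequence:
  fixes \<theta> \<alpha> :: "nat \<Rightarrow> real"
  assumes indep: "\<And>c i. (\<Sum>i<d. real_of_int (c i) * \<theta> i) = 0 \<Longrightarrow> i < d \<Longrightarrow> c i = 0"
  obtains \<tau> :: "nat \<Rightarrow> real"
  where "\<And>i. i < d \<Longrightarrow> (\<lambda>k. cis (\<tau> k * \<theta> i)) \<longlonglongrightarrow> cis (2 * pi * \<alpha> i)"
proof -
  interpret int_module: Modules.module "\<lambda>r. (*) (real_of_int r)"
    by (simp add: Modules.module.intro distrib_left mult.commute)
  have inj: "inj_on \<theta> {..<d}"
  proof (rule inj_onI, rule ccontr)
    fix i j assume ij: "i \<in> {..<d}" "j \<in> {..<d}" "\<theta> i = \<theta> j" "i \<noteq> j"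
    \<comment> \<open>Two equal entries would satisfy the integer relation with coefficients 1 and
      -1.\<close>
    define c :: "nat \<Rightarrow> int" where "c k = (if k = i then 1 else 0) - (if k = j then 1 else 0)" for k
    have "(\<Sum>k<d. real_of_int (c k) * \<theta> k)
        = (\<Sum>k<d. (if k = i then \<theta> k else 0) - (if k = j then \<theta> k else 0))"
      by (rule sum.cong) (auto simp: c_def)
    also have "\<dots> = 0" using ij by (simp add: sum_subtractf)
    finally have "c i = 0" using indep ij by blast
    then show False using ij by (simp add: c_def)
  qed
  have "int_module.independent (\<theta> ` {..<d})"
    unfolding int_module.dependent_explicit
  proof (clarify)
    fix T u v assume T: "finite T" "T \<subseteq> \<theta> ` {..<d}" "(\<Sum>v\<in>T. real_of_int (u v) * v) = 0" "v \<in> T" "u v \<noteq> 0"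
    define c where "c i = (if \<theta> i \<in> T then u (\<theta> i) else 0)" for i
    have "(\<Sum>i<d. real_of_int (c i) * \<theta> i)
        = (\<Sum>v\<in>\<theta> ` {..<d}. real_of_int (if v \<in> T then u v else 0) * v)"
      by (subst sum.reindex[OF inj]) (simp add: c_def)
    also have "\<dots> = (\<Sum>v\<in>T. real_of_int (u v) * v)"
      using T by (intro sum.mono_neutral_cong_right) auto
    finally have "\<And>i. i < d \<Longrightarrow> c i = 0" using indep T by simp
    moreover obtain i where "i < d" "v = \<theta> i" using T by auto
    ultimately show False using T by (force simp: c_def)
  qed
  from Kronecker_thm_1[OF this inj]
  have "\<exists>t h. \<forall>i<d. \<bar>t * \<theta> i - of_int (h i) - \<alpha> i\<bar> < 1 / real (Suc k)" for k
    by (metis (no_types) of_nat_0_less_iff zero_less_Suc zero_less_divide_1_iff)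
  then obtain t h where th: "\<And>k i. i < d \<Longrightarrow> \<bar>t k * \<theta> i - real_of_int (h k i) - \<alpha> i\<bar> < 1 / real (Suc k)"
    by metis
  have "(\<lambda>k. cis (2 * pi * t k * \<theta> i)) \<longlonglongrightarrow> cis (2 * pi * \<alpha> i)" if "i < d" for i
  proof -
    have "(\<lambda>k. t k * \<theta> i - real_of_int (h k i) - \<alpha> i) \<longlonglongrightarrow> 0"
      by (rule Lim_null_comparison[OF _ lim_1_over_n[THEN LIMSEQ_Suc]])
        (use th[OF that] in \<open>auto intro!: always_eventually less_imp_le\<close>)
    then have "(\<lambda>k. t k * \<theta> i - real_of_int (h k i)) \<longlonglongrightarrow> \<alpha> i"
      by (simp add: LIM_zero_iff)
    then have "(\<lambda>k. cis (2 * pi * (t k * \<theta> i - real_of_int (h k i)))) \<longlonglongrightarrow> cis (2 * pi * \<alpha> i)"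
      unfolding cis_conv_exp by (intro tendsto_intros)
    moreover have "cis (2 * pi * (t k * \<theta> i - real_of_int (h k i))) = cis (2 * pi * t k * \<theta> i)" for k
      using cis_multiple_2pi[of "real_of_int (h k i)"]
      by (simp add: right_diff_distrib cis_divide[symmetric] mult.assoc)
    ultimately show ?thesis by simp
  qed
  then show ?thesis using that[of "\<lambda>k. 2 * pi * t k"] by blast
qed

text \<open>Under \<open>cis\<close> the sum becomes a product. A coefficient -1 conjugates its
  factor, which does not change the limit since that is real.\<close>

lemma tendsto_cis_signed_sum:
  fixes y :: "'i \<Rightarrow> 'k \<Rightarrow> real" and s :: "'i \<Rightarrow> real"
  assumes "\<And>m. m \<in> I \<Longrightarrow> ((\<lambda>k. cis (y m k)) \<longlongrightarrow> of_real (s m)) F"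
    and e: "\<And>m. m \<in> I \<Longrightarrow> e m \<in> {1, -1}"
  shows "((\<lambda>k. cis (\<Sum>m\<in>I. e m * y m k)) \<longlongrightarrow> of_real (\<Prod>m\<in>I. s m)) F"
proof -
  have "((\<lambda>k. cis (e m * y m k)) \<longlongrightarrow> of_real (s m)) F" if "m \<in> I" for m
  proof (cases "e m = 1")
    case False
    have "((\<lambda>k. cnj (cis (y m k))) \<longlongrightarrow> cnj (of_real (s m))) F"
      using assms that by (intro tendsto_cnj) auto
    then show ?thesis using e[OF that] False by (simp add: cis_cnj)
  qed (use assms that in simp)
  then have "((\<lambda>k. \<Prod>m\<in>I. cis (e m * y m k)) \<longlongrightarrow> (\<Prod>m\<in>I. of_real (s m))) F"
    by (intro tendsto_prod) auto
  moreover have "(\<Prod>m\<in>I. cis (e m * y m k)) = cis (\<Sum>m\<in>I. e m * y m k)" for k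
    by (induction I rule: infinite_finite_induct) (simp_all add: cis_mult)
  ultimately show ?thesis by simp
qed

text \<open>Multiplying the relation by \<open>- e m0\<close> expresses \<open>y m0\<close> as a
  signed sum of the other terms. The product of their limits is \<open>s m0\<close>, because all
  signs together multiply to 1.\<close>

lemma tendsto_cis_remaining_term:
  fixes y :: "'i \<Rightarrow> 'k \<Rightarrow> real" and s :: "'i \<Rightarrow> real"
  assumes I: "finite I" "m0 \<in> I"
    and lim: "\<And>m. m \<in> I \<Longrightarrow> m \<noteq> m0 \<Longrightarrow> ((\<lambda>k. cis (y m k)) \<longlongrightarrow> of_real (s m)) F"
    and e: "\<And>m. m \<in> I \<Longrightarrow> e m \<in> {1, -1}"
    and s: "s m0 \<in> {1, -1}" "(\<Prod>m\<in>I. s m) = 1"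
    and sum0: "\<And>k. (\<Sum>m\<in>I. e m * y m k) = 0"
  shows "((\<lambda>k. cis (y m0 k)) \<longlongrightarrow> of_real (s m0)) F"
proof -
  have "((\<lambda>k. cis (\<Sum>m\<in>I-{m0}. (- e m0 * e m) * y m k)) \<longlongrightarrow> of_real (\<Prod>m\<in>I-{m0}. s m)) F"
    using lim e[OF I(2)] e by (intro tendsto_cis_signed_sum) force+
  moreover have "(\<Prod>m\<in>I-{m0}. s m) = s m0"
    using s I by (auto simp: prod.remove)
  moreover have "(\<Sum>m\<in>I-{m0}. (- e m0 * e m) * y m k) = y m0 k" for k
  proof -
    have "(\<Sum>m\<in>I-{m0}. (- e m0 * e m) * y m k) = - e m0 * (\<Sum>m\<in>I-{m0}. e m * y m k)"
      by (simp add: sum_distrib_left mult.assoc)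
    also have "(\<Sum>m\<in>I-{m0}. e m * y m k) = - e m0 * y m0 k"
      using sum0[of k] I by (simp add: sum.remove)
    finally show ?thesis using e[OF I(2)] by auto
  qed
  ultimately show ?thesis by simp
qed

text \<open>The phases \<open>(-1)^(j + 1)\<close> required by the transfer, except at multiples of \<open>2 p\<close>, where the value
  is forced by the relations between the eigenvalues.\<close>

definition path_sign :: "nat \<Rightarrow> int \<Rightarrow> real" where
  "path_sign p j = (if even j \<and> \<not> int p dvd j then -1 else 1)"

text \<open>For odd \<open>j\<close> every factor is 1. For even \<open>j\<close>, invertibility of
  \<open>2 ^ t\<close> modulo \<open>p\<close> makes exactly one of the \<open>p\<close> indices
  divisible by \<open>p\<close>, which leaves an even number of factors -1. So the desired signs are
  compatible with the relations between eigenvalues.\<close>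

lemma prod_path_sign:
  assumes t: "t \<ge> 1" and p: "prime p" "odd p"
  shows "(\<Prod>m<p. path_sign p (j + 2 ^ t * int m)) = 1"
proof (cases "even j")
  case False
  then show ?thesis using t by (simp add: path_sign_def)
next
  case True
  have p1: "p > 1" using p prime_gt_1_nat by blast
  have cop: "coprime (2 ^ t :: int) (int p)" using p by simp
  obtain x where "[2 ^ t * x = - j] (mod int p)"
    using cong_solve_coprime_int[OF cop] by (metis cong_scalar_right mult.assoc mult_1)
  then have "[j + 2 ^ t * x = 0] (mod int p)"
    by (metis cong_add_lcancel add.right_inverse)
  moreover have "[x mod int p = x] (mod int p)" by simp
  ultimately have x: "[j + 2 ^ t * (x mod int p) = 0] (mod int p)"
    by (metis cong_add_lcancel cong_scalar_left cong_trans)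
  define m0 where "m0 = nat (x mod int p)"
  have m0: "int p dvd j + 2 ^ t * int m0" "m0 < p"
    using x p1 by (simp_all add: m0_def cong_0_iff nat_less_iff)
  have uniq: "m = m0" if "m < p" "int p dvd j + 2 ^ t * int m" for m
  proof -
    have "int p dvd (j + 2 ^ t * int m) - (j + 2 ^ t * int m0)"
      using that m0 by (intro dvd_diff) auto
    then have "int p dvd 2 ^ t * (int m - int m0)" by (simp add: algebra_simps)
    then have "int p dvd int m - int m0"
      using cop by (simp add: coprime_commute coprime_dvd_mult_right_iff)
    then have "[int m = int m0] (mod int p)" by (simp add: cong_iff_dvd_diff)
    then show ?thesis using that m0 by (simp add: cong_int_iff cong_less_modulus_unique_nat)
  qed
  have "(\<Prod>m<p. path_sign p (j + 2 ^ t * int m))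
      = path_sign p (j + 2 ^ t * int m0) * (\<Prod>m\<in>{..<p}-{m0}. path_sign p (j + 2 ^ t * int m))"
    using m0 by (simp add: prod.remove)
  also have "(\<Prod>m\<in>{..<p}-{m0}. path_sign p (j + 2 ^ t * int m)) = (\<Prod>m\<in>{..<p}-{m0}. -1)"
    using uniq True t by (intro prod.cong) (auto simp: path_sign_def)
  also have "\<dots> = 1" using m0 p by simp
  finally show ?thesis using m0 by (simp add: path_sign_def)
qed

text \<open>The first \<open>d\<close> phases are free. Each further one is the single unknown of a
  relation among \<open>p\<close> indices spaced by \<open>2 ^ t\<close>. Integer indices let such a
  relation run below zero, where evenness of the cosine applies.\<close>

lemma path_phases:
  fixes n p t :: nat
  assumes t: "t \<ge> 1" and p: "prime p" "odd p" and n: "n = 2 ^ t * p"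
  obtains \<tau> :: "nat \<Rightarrow> real"
  where "\<And>j::int. (\<lambda>k. cis (\<tau> k * (2 * cos (pi * real_of_int j / real n)))) \<longlonglongrightarrow> of_real (path_sign p j)"
proof -
  have p1: "p > 1" using p prime_gt_1_nat by blast
  obtain h where h: "p = 2 * h + 1" using p by (elim oddE)
  define d where "d = 2 ^ (t - 1) * (p - 1)"
  have dh: "d = 2 ^ t * h" using t by (simp add: d_def h power_eq_if)
  define x :: "int \<Rightarrow> real" where "x j = 2 * cos (pi * real_of_int j / real n)" for j
  have x_minus: "x (- j) = x j" for j by (simp add: x_def)
  have s_minus: "path_sign p (- j) = path_sign p j" for j by (simp add: path_sign_def)
  have indep: "c i = 0" if sum0: "(\<Sum>i<d. real_of_int (c i) * x (int (Suc i))) = 0" and "i < d" for c i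
  proof -
    have "(\<Sum>j=1..d. real_of_int (c (j - 1)) * (2 * cos (pi * real j / real n))) = 0"
      using sum0 by (simp add: x_def sum.atLeast1_atMost_eq)
    from cos_linear_independent[OF t p n d_def this, of "Suc i"] show ?thesis
      using \<open>i < d\<close> by simp
  qed
  \<comment> \<open>Zero and half a turn realise the signs 1 and -1.\<close>
  obtain \<tau> where \<tau>: "\<And>i. i < d \<Longrightarrow> (\<lambda>k. cis (\<tau> k * x (int (Suc i))))
      \<longlonglongrightarrow> cis (2 * pi * (if path_sign p (int (Suc i)) = 1 then 0 else 1 / 2))"
  proof (rule Kronecker_sequence[where d = d and \<theta> = "\<lambda>i. x (int (Suc i))" and
        \<alpha> = "\<lambda>i. if path_sign p (int (Suc i)) = 1 then 0 else 1 / 2"])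
    show "c i = 0" if "(\<Sum>i<d. real_of_int (c i) * x (int (Suc i))) = 0" "i < d" for c i
      using that by (rule indep)
  qed blast
  have \<tau>': "(\<lambda>k. cis (\<tau> k * x j)) \<longlonglongrightarrow> of_real (path_sign p j)" if "0 < j" "j \<le> int d" for j
  proof -
    have "nat (j - 1) < d" "int (Suc (nat (j - 1))) = j" using that by auto
    moreover have "cis (2 * pi * (if path_sign p j = 1 then 0 else 1 / 2)) = of_real (path_sign p j)"
      by (simp add: path_sign_def)
    ultimately show ?thesis using \<tau>[of "nat (j - 1)"] by simp
  qed
  have step: "(\<lambda>k. cis (\<tau> k * x (j + 2 ^ t * int m0))) \<longlonglongrightarrow> of_real (path_sign p (j + 2 ^ t * int m0))"
    if "m0 < p" "\<And>m. m < p \<Longrightarrow> m \<noteq> m0 \<Longrightarrow>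
      (\<lambda>k. cis (\<tau> k * x (j + 2 ^ t * int m))) \<longlonglongrightarrow> of_real (path_sign p (j + 2 ^ t * int m))" for j m0
  proof (rule tendsto_cis_remaining_term[where I = "{..<p}" and e = "\<lambda>m. (-1) ^ m" and
        y = "\<lambda>m k. \<tau> k * x (j + 2 ^ t * int m)" and s = "\<lambda>m. path_sign p (j + 2 ^ t * int m)"])
    fix k
    have "(\<Sum>m<p. (-1) ^ m * (\<tau> k * x (j + 2 ^ t * int m)))
      = 2 * \<tau> k * (\<Sum>m<p. (-1) ^ m * cos (pi * (real_of_int j + real (2 ^ t * m)) / real (2 ^ t * p)))"
      by (simp add: x_def n sum_distrib_left mult_ac)
    then show "(\<Sum>m<p. (-1) ^ m * (\<tau> k * x (j + 2 ^ t * int m))) = 0"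
      using alternating_cos_sum[of p "2 ^ t" "real_of_int j"] p p1 by simp
  next
    fix m show "(-1) ^ m \<in> {1, - 1 :: real}" by (cases "even m") auto
  qed (use that prod_path_sign[OF t p] in \<open>auto simp: path_sign_def\<close>)
  have nonneg: "(\<lambda>k. cis (\<tau> k * x (int J))) \<longlonglongrightarrow> of_real (path_sign p (int J))" for J
  proof (induction J rule: less_induct)
    case (less J)
    consider "J = 0" | "0 < J" "J \<le> d" | "J > d" by linarith
    then show ?case
    proof cases
      case 1
      \<comment> \<open>The relation starting at \<open>- d\<close> is symmetric about 0: apart from
        the middle term \<open>m = h\<close> its indices are plus or minus \<open>2 ^ t * i\<close>
        with \<open>1 <= i <= h\<close>, all in the free range.\<close>
      have "(\<lambda>k. cis (\<tau> k * x (- int d + 2 ^ t * int m)))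
          \<longlonglongrightarrow> of_real (path_sign p (- int d + 2 ^ t * int m))" if "m < p" "m \<noteq> h" for m
      proof (cases "m > h")
        case True
        then obtain i where i: "m = h + i" "i > 0" using less_imp_add_positive by blast
        then have "- int d + 2 ^ t * int m = 2 ^ t * int i" by (simp add: dh algebra_simps)
        moreover have "2 ^ t * int i \<le> int d" using i that by (simp add: dh h)
        ultimately show ?thesis using \<tau>'[of "2 ^ t * int i"] i by simp
      next
        case False
        then have "m < h" using that by simp
        then obtain i where i: "h = m + i" "i > 0" using less_imp_add_positive by blast
        then have "- int d + 2 ^ t * int m = - (2 ^ t * int i)" by (simp add: dh algebra_simps)
        moreover have "2 ^ t * int i \<le> int d" using i by (simp add: dh)
        ultimately show ?thesis using \<tau>'[of "2 ^ t * int i"] i by (simp only: x_minus s_minus) simp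
      qed
      from step[of h "- int d", OF _ this] show ?thesis using 1 h by (simp add: dh)
    next
      case 2
      then show ?thesis using \<tau>' by simp
    next
      case 3
      \<comment> \<open>This start makes \<open>J\<close> the last index of the relation; since
        \<open>J > d\<close>, all the others are smaller than \<open>J\<close> in absolute
        value.\<close>
      define j where "j = int J - 2 * int d"
      have top: "j + 2 ^ t * int (p - 1) = int J" by (simp add: j_def dh h)
      have "(\<lambda>k. cis (\<tau> k * x (j + 2 ^ t * int m))) \<longlonglongrightarrow> of_real (path_sign p (j + 2 ^ t * int m))"
        if "m < p" "m \<noteq> p - 1" for m
      proof -
        have "2 ^ t * int m < 2 ^ t * int (p - 1)" using that by simp
        then have lt: "j + 2 ^ t * int m < int J" using top by linarith
        have "2 ^ t * int m \<ge> 0" by simp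
        then have gt: "j + 2 ^ t * int m > - int J" using 3 unfolding j_def by linarith
        show ?thesis
        proof (cases "j + 2 ^ t * int m \<ge> 0")
          case True
          then show ?thesis using less.IH[of "nat (j + 2 ^ t * int m)"] lt by simp
        next
          case False
          then have "(\<lambda>k. cis (\<tau> k * x (- (j + 2 ^ t * int m))))
              \<longlonglongrightarrow> of_real (path_sign p (- (j + 2 ^ t * int m)))"
            using less.IH[of "nat (- (j + 2 ^ t * int m))"] gt by simp
          then show ?thesis by (simp only: x_minus s_minus)
        qed
      qed
      from step[of "p - 1" j, OF _ this] show ?thesis using p1 unfolding top by simp
    qed
  qed
  have "(\<lambda>k. cis (\<tau> k * x j)) \<longlonglongrightarrow> of_real (path_sign p j)" for j
    using nonneg[of "nat j"] nonneg[of "nat (- j)"] by (cases "j \<ge> 0") (simp_all add: x_minus s_minus)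
  then show ?thesis using that unfolding x_def by blast
qed

section \<open>The spectrum of the path\<close>

text \<open>The power series is summed term by term against \<open>w\<close>. Left eigenvectors are
  the convenient side because the evolved vector is later paired with \<open>w\<close> from the
  left.\<close>

lemma exp_mat_left_eigenvector:
  assumes A: "A \<in> carrier_mat n n"
    and ev: "\<And>j. j < n \<Longrightarrow> (\<Sum>i<n. w i * A $$ (i, j)) = \<mu> * w j"
    and j: "j < n"
  shows "(\<Sum>i<n. w i * exp_mat A $$ (i, j)) = exp \<mu> * w j"
proof -
  have pow: "(\<Sum>i<n. w i * (A ^\<^sub>m k) $$ (i, j)) = \<mu> ^ k * w j" if "j < n" for k j
    using that
  proof (induction k arbitrary: j)
    case 0
    have "(\<Sum>i<n. w i * (A ^\<^sub>m 0) $$ (i, j)) = (\<Sum>i<n. if i = j then w i else 0)"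
      using A 0 by (intro sum.cong) auto
    then show ?case using 0 by simp
  next
    case (Suc k)
    have "(A ^\<^sub>m Suc k) $$ (i, j) = (\<Sum>l<n. (A ^\<^sub>m k) $$ (i, l) * A $$ (l, j))" if "i < n" for i
      using A Suc.prems that pow_carrier_mat[OF A, of k]
      by (simp add: scalar_prod_def lessThan_atLeast0)
    then have "(\<Sum>i<n. w i * (A ^\<^sub>m Suc k) $$ (i, j))
        = (\<Sum>i<n. \<Sum>l<n. w i * (A ^\<^sub>m k) $$ (i, l) * A $$ (l, j))"
      by (intro sum.cong) (simp_all add: sum_distrib_left mult.assoc)
    also have "\<dots> = (\<Sum>l<n. (\<Sum>i<n. w i * (A ^\<^sub>m k) $$ (i, l)) * A $$ (l, j))"
      by (subst sum.swap) (simp add: sum_distrib_right)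
    also have "\<dots> = \<mu> ^ k * (\<Sum>l<n. w l * A $$ (l, j))"
      by (simp add: Suc.IH sum_distrib_left mult.assoc)
    finally show ?case by (simp add: ev[OF Suc.prems])
  qed
  have "(\<lambda>k. \<Sum>i<n. w i * ((A ^\<^sub>m k) $$ (i, j) / fact k))
      sums (\<Sum>i<n. w i * (\<Sum>k. (A ^\<^sub>m k) $$ (i, j) / fact k))"
    using summable_exp_mat[OF A _ j] by (intro sums_sum sums_mult summable_sums) auto
  moreover have "(\<Sum>i<n. w i * ((A ^\<^sub>m k) $$ (i, j) / fact k)) = \<mu> ^ k /\<^sub>R fact k * w j" for k
  proof -
    have "(\<Sum>i<n. w i * ((A ^\<^sub>m k) $$ (i, j) / fact k))
        = (\<Sum>i<n. w i * (A ^\<^sub>m k) $$ (i, j)) / fact k"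
      by (simp add: sum_divide_distrib)
    then show ?thesis using pow[OF j] by (simp add: scaleR_conv_of_real field_simps)
  qed
  moreover have "(\<lambda>k. \<mu> ^ k /\<^sub>R fact k * w j) sums (exp \<mu> * w j)"
    by (intro sums_mult2 exp_converges)
  ultimately have "(\<Sum>i<n. w i * (\<Sum>k. (A ^\<^sub>m k) $$ (i, j) / fact k)) = exp \<mu> * w j"
    by (simp add: sums_unique2)
  then show ?thesis using A j by (simp add: exp_mat_def)
qed

lemma path_edges_iff: "{i + 1, j + 1} \<in> path_edges n \<longleftrightarrow> (j = i + 1 \<and> j < n) \<or> (i = j + 1 \<and> i < n)"
  by (auto simp: path_edges_def doubleton_eq_iff)

lemma path_degree:
  assumes "l < n"
  shows "card {e \<in> path_edges n. l + 1 \<in> e} = (if l > 0 then 1 else 0) + (if l + 1 < n then 1 else 0)"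
proof -
  have "{e \<in> path_edges n. l + 1 \<in> e}
      = (if l > 0 then {{l, l + 1}} else {}) \<union> (if l + 1 < n then {{l + 1, l + 2}} else {})"
    using assms by (auto simp: path_edges_def)
  then show ?thesis by (auto simp: doubleton_eq_iff)
qed

text \<open>Each edge at the vertex contributes one difference, the form to which
  \<open>path_eigvec_diff\<close> applies; the conditionals drop the absent neighbours at the two
  ends.\<close>

lemma path_laplacian_column_sum:
  assumes l: "l < n"
  shows "(\<Sum>i<n. w i * laplacian_mat n (path_edges n) $$ (i, l))
    = (if l > 0 then w l - w (l - 1) else 0) + (if l + 1 < n then w l - w (l + 1) else 0)"
proof -
  have "(\<Sum>i<n. w i * laplacian_mat n (path_edges n) $$ (i, l))
     = (\<Sum>i<n. (if i = l then w i * of_nat (card {e \<in> path_edges n. l + 1 \<in> e}) else 0)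
        - (if i + 1 = l then w i else 0) - (if i = l + 1 then w i else 0))"
    using l path_edges_iff[of _ l n]
    by (intro sum.cong) (auto simp: laplacian_mat_def degree_mat_def adjacency_mat_def)
  also have "\<dots> = w l * of_nat (card {e \<in> path_edges n. l + 1 \<in> e})
      - (\<Sum>i<n. if i + 1 = l then w i else 0) - (if l + 1 < n then w (l + 1) else 0)"
    using l by (simp add: sum_subtractf)
  also have "(\<Sum>i<n. if i + 1 = l then w i else 0) = (if l > 0 then w (l - 1) else 0)"
  proof (cases l)
    case (Suc l')
    have "(\<Sum>i<n. if i + 1 = l then w i else 0) = (\<Sum>i<n. if i = l' then w i else 0)"
      by (rule sum.cong) (auto simp: Suc)
    then show ?thesis using l Suc by simp
  qed simp
  finally show ?thesis unfolding path_degree[OF l] by (auto simp: algebra_simps)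
qed

text \<open>The row index \<open>i\<close> starts from 0, so it stands for the vertex \<open>i + 1\<close>.\<close>

definition path_eigvec :: "nat \<Rightarrow> nat \<Rightarrow> nat \<Rightarrow> real" where
  "path_eigvec n j i = cos (pi * real j * (2 * real i + 1) / (2 * real n))"

text \<open>For \<open>0 < l < n\<close> this is the product of eigenvector \<open>j\<close> with
  the edge vector of \<open>{l, l + 1}\<close>. The closed form also covers \<open>l = 0\<close> and
  \<open>l = n\<close>, where it vanishes.\<close>

definition path_edge_coeff :: "nat \<Rightarrow> nat \<Rightarrow> nat \<Rightarrow> real" where
  "path_edge_coeff n j l = 2 * sin (pi * real j * real l / real n) * sin (pi * real j / (2 * real n))"

lemma path_eigvec_diff:
  assumes "n > 0"
  shows "path_eigvec n j l - path_eigvec n j (Suc l) = path_edge_coeff n j (Suc l)"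
proof -
  define y where "y = pi * real j / (2 * real n)"
  have 1: "pi * real j * (2 * real l + 1) / (2 * real n) = 2 * y * real (Suc l) - y"
    "pi * real j * (2 * real (Suc l) + 1) / (2 * real n) = 2 * y * real (Suc l) + y"
    "pi * real j * real (Suc l) / real n = 2 * y * real (Suc l)"
    using assms by (simp_all add: y_def field_simps)
  show ?thesis
    unfolding path_eigvec_def path_edge_coeff_def 1 y_def[symmetric] cos_add cos_diff by simp
qed

lemma path_edge_coeff_diff:
  assumes "n > 0"
  shows "path_edge_coeff n j (Suc l) - path_edge_coeff n j l
    = (2 - 2 * cos (pi * real j / real n)) * path_eigvec n j l"
proof -
  define y where "y = pi * real j / (2 * real n)"
  define x where "x = pi * real j * (2 * real l + 1) / (2 * real n)"
  have 1: "pi * real j * real (Suc l) / real n = x + y" "pi * real j * real l / real n = x - y"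
    "pi * real j / real n = 2 * y"
    using assms by (simp_all add: x_def y_def field_simps)
  show ?thesis
    unfolding path_edge_coeff_def path_eigvec_def 1 y_def[symmetric] x_def[symmetric]
      sin_add sin_diff cos_double_sin
    by (simp add: algebra_simps power2_eq_square)
qed

lemma path_edge_coeff_0: "path_edge_coeff n j 0 = 0"
  by (simp add: path_edge_coeff_def)

text \<open>Reflecting the path multiplies eigenvector \<open>j\<close> by \<open>(-1) ^ j\<close>;
  the additional minus sign comes from the reversed orientation of the edge.\<close>

lemma path_edge_coeff_mirror:
  assumes "n > 0" "a \<le> n"
  shows "path_edge_coeff n j (n - a) = - ((-1) ^ j) * path_edge_coeff n j a"
proof -
  have "pi * real j * real (n - a) / real n = real j * pi - pi * real j * real a / real n"
    using assms by (simp add: field_simps of_nat_diff)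
  then show ?thesis by (simp add: path_edge_coeff_def sin_diff)
qed

text \<open>The two differences in a column are edge coefficients at \<open>l\<close> and
  \<open>l + 1\<close>. Their vanishing at 0 and \<open>n\<close> accounts for the end vertices, so
  one identity serves all columns.\<close>

lemma path_laplacian_left_eigenvector:
  assumes l: "l < n"
  shows "(\<Sum>i<n. of_real (path_eigvec n j i) * laplacian_mat n (path_edges n) $$ (i, l))
    = of_real (2 - 2 * cos (pi * real j / real n)) * complex_of_real (path_eigvec n j l)"
proof -
  have n: "n > 0" using l by simp
  have "path_edge_coeff n j n = 0"
    using path_edge_coeff_mirror[of n n j] n by (simp add: path_edge_coeff_0)
  then have "(if l + 1 < n then path_eigvec n j l - path_eigvec n j (l + 1) else 0)
      = path_edge_coeff n j (Suc l)"
    using path_eigvec_diff[OF n, of j l] l by (cases "Suc l = n") auto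
  moreover have "(if l > 0 then path_eigvec n j l - path_eigvec n j (l - 1) else 0)
      = - path_edge_coeff n j l"
    using path_eigvec_diff[OF n, of j "l - 1"] by (cases l) (auto simp: path_edge_coeff_0)
  ultimately have "(if l > 0 then path_eigvec n j l - path_eigvec n j (l - 1) else 0)
      + (if l + 1 < n then path_eigvec n j l - path_eigvec n j (l + 1) else 0)
      = (2 - 2 * cos (pi * real j / real n)) * path_eigvec n j l"
    using path_edge_coeff_diff[OF n, of j l] by simp
  from arg_cong[OF this, of complex_of_real] show ?thesis
    unfolding path_laplacian_column_sum[OF l] by (simp split: if_splits)
qed

lemma sum_cos_roots_of_unity:
  assumes "0 < h" "h < N"
  shows "(\<Sum>j<N. cos (2 * pi * real h * real j / real N)) = 0"
proof -
  define r where "r = cis (2 * pi * real h / real N)"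
  have "r ^ N = 1" using assms by (simp add: r_def Complex.DeMoivre)
  moreover have "r \<noteq> 1"
  proof
    assume "r = 1"
    then have "cos (2 * pi * real h / real N) = 1" by (simp add: r_def complex_eq_iff)
    then obtain m :: int where "2 * pi * real h / real N = of_int m * 2 * pi"
      using cos_one_2pi_int by blast
    then have "real h = of_int m * real N" using assms by (simp add: field_simps)
    then have "int h = m * int N" by (metis of_int_eq_iff of_int_mult of_int_of_nat_eq)
    then have "int N dvd int h" by simp
    then show False using assms by (simp add: nat_dvd_not_less)
  qed
  ultimately have "(\<Sum>j<N. r ^ j) = 0" by (simp add: sum_gp_strict)
  then have "Re (\<Sum>j<N. r ^ j) = 0" by simp
  then show ?thesis by (simp add: r_def Complex.DeMoivre mult_ac)
qed

text \<open>Over \<open>2 * n\<close> indices every nonconstant mode occurs twice (\<open>j\<close>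
  and \<open>2 * n - j\<close> differ by a sign), the constant one once, and \<open>j = n\<close>
  gives zero. This yields the correct weights and turns both cosine sums into full sums over roots
  of unity.\<close>

lemma path_eigvec_completeness:
  assumes "i < n" "l < n"
  shows "(\<Sum>j<2 * n. path_eigvec n j i * path_eigvec n j l) = (if i = l then real n else 0)"
proof -
  define C where "C h = (\<Sum>j<2 * n. cos (2 * pi * real h * real j / real (2 * n)))" for h
  define k where "k = (if i \<le> l then l - i else i - l)"
  have "2 * (path_eigvec n j i * path_eigvec n j l)
      = cos (2 * pi * real k * real j / real (2 * n)) + cos (2 * pi * real (i + l + 1) * real j / real (2 * n))" for j
  proof -
    define x where "x u = pi * real j * (2 * real u + 1) / (2 * real n)" for u
    have "2 * (path_eigvec n j i * path_eigvec n j l) = cos (x i - x l) + cos (x i + x l)"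
      by (simp add: path_eigvec_def x_def[symmetric] cos_times_cos)
    also have "x i + x l = 2 * pi * real (i + l + 1) * real j / real (2 * n)"
      using assms by (simp add: x_def field_simps)
    also have "x i - x l = 2 * pi * (real i - real l) * real j / real (2 * n)"
      using assms by (simp add: x_def field_simps)
    also have "cos \<dots> = cos (2 * pi * real k * real j / real (2 * n))"
    proof (cases "i \<le> l")
      case True
      have "2 * pi * (real i - real l) * real j / real (2 * n) = - (2 * pi * real k * real j / real (2 * n))"
        using True by (simp add: k_def of_nat_diff algebra_simps minus_divide_left)
      then show ?thesis by (simp only: cos_minus)
    qed (simp add: k_def of_nat_diff)
    finally show ?thesis .
  qed
  then have "2 * (\<Sum>j<2 * n. path_eigvec n j i * path_eigvec n j l) = C k + C (i + l + 1)"
    by (simp add: C_def sum_distrib_left sum.distrib)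
  also have "C (i + l + 1) = 0"
    unfolding C_def using assms by (intro sum_cos_roots_of_unity) auto
  also have "C k = (if i = l then 2 * real n else 0)"
  proof (cases "i = l")
    case False
    then show ?thesis using assms sum_cos_roots_of_unity[of k "2 * n"]
      by (auto simp: C_def k_def)
  qed (simp add: C_def k_def)
  finally show ?thesis by (auto split: if_splits)
qed

section \<open>Edge state transfer on the path\<close>

text \<open>The target phase is written as \<open>- cis (\<phi> - 2 * \<tau>)\<close> so that the 2
  in the eigenvalue cancels and the minus sign offsets the one in
  \<open>path_edge_coeff_mirror\<close>; a factor of modulus one then drops out.\<close>

lemma path_edge_transfer_spectral:
  fixes \<tau> \<phi> :: real
  assumes a: "1 \<le> a" "a < n"
  defines "y \<equiv> transition_mat n (path_edges n) \<tau> *\<^sub>v (vertex_vec n a - vertex_vec n (a + 1))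
      - (- cis (\<phi> - 2 * \<tau>)) \<cdot>\<^sub>v (vertex_vec n (n - a) - vertex_vec n (n - a + 1))"
  shows "cmod (\<Sum>i<n. of_real (path_eigvec n j i) * y $ i)
    = \<bar>path_edge_coeff n j a\<bar> * cmod (cis (\<tau> * (2 * cos (pi * real j / real n)) - \<phi>) - (-1) ^ j)"
proof -
  define v where "v i = complex_of_real (path_eigvec n j i)" for i
  define U where "U = transition_mat n (path_edges n) \<tau>"
  define \<theta> where "\<theta> = 2 - 2 * cos (pi * real j / real n)"
  define \<gamma> where "\<gamma> = - cis (\<phi> - 2 * \<tau>)"
  have n: "n > 0" using a by simp
  have L: "laplacian_mat n (path_edges n) \<in> carrier_mat n n"
    unfolding laplacian_mat_def degree_mat_def adjacency_mat_def
    by (intro minus_carrier_mat) simp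
  then have U: "U \<in> carrier_mat n n" by (simp add: U_def transition_mat_def exp_mat_def)
  have Uv: "(\<Sum>i<n. v i * U $$ (i, l)) = cis (- \<tau> * \<theta>) * v l" if "l < n" for l
  proof -
    have "(\<Sum>i<n. v i * U $$ (i, l)) = exp (- \<i> * of_real \<tau> * of_real \<theta>) * v l"
      unfolding U_def transition_mat_def
    proof (rule exp_mat_left_eigenvector)
      fix l assume l: "l < n"
      have "(\<Sum>i<n. v i * ((- \<i> * of_real \<tau>) \<cdot>\<^sub>m laplacian_mat n (path_edges n)) $$ (i, l))
        = (- \<i> * of_real \<tau>) * (\<Sum>i<n. v i * laplacian_mat n (path_edges n) $$ (i, l))"
        unfolding sum_distrib_left using L l by (intro sum.cong) auto
      then show "(\<Sum>i<n. v i * ((- \<i> * of_real \<tau>) \<cdot>\<^sub>m laplacian_mat n (path_edges n)) $$ (i, l))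
        = - \<i> * of_real \<tau> * of_real \<theta> * v l"
        using path_laplacian_left_eigenvector[OF l, of j] by (simp add: v_def \<theta>_def mult.assoc)
    qed (use L that in auto)
    then show ?thesis by (simp add: cis_conv_exp mult.assoc)
  qed
  have v_diff: "v l - v (Suc l) = of_real (path_edge_coeff n j (Suc l))" for l
    using path_eigvec_diff[OF n, of j l] by (simp add: v_def flip: of_real_diff)
  have y: "y $ i = U $$ (i, a - 1) - U $$ (i, a)
      - \<gamma> * ((if i = n - a - 1 then 1 else 0) - (if i = n - a then 1 else 0))" if "i < n" for i
  proof -
    have "(U *\<^sub>v (vertex_vec n a - vertex_vec n (a + 1))) $ i = U $$ (i, a - 1) - U $$ (i, a)"
    proof -
      have "(U *\<^sub>v (vertex_vec n a - vertex_vec n (a + 1))) $ i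
          = row U i \<bullet> unit_vec n (a - 1) - row U i \<bullet> unit_vec n a"
        using U that a by (simp add: vertex_vec_def scalar_prod_minus_distrib[of _ n])
      then show ?thesis using U that a by (simp add: scalar_prod_right_unit)
    qed
    then show ?thesis using that a U
      by (simp add: y_def U_def[symmetric] \<gamma>_def vertex_vec_def)
  qed
  \<comment> \<open>Vertex \<open>n - a\<close> has index \<open>n - a - 1\<close>;
    \<open>a < n\<close> keeps the truncated subtraction exact.\<close>
  have S: "Suc (n - Suc a) = n - a" using a by simp
  have "(\<Sum>i<n. v i * y $ i) = (\<Sum>i<n. v i * U $$ (i, a - 1)) - (\<Sum>i<n. v i * U $$ (i, a))
      - \<gamma> * ((\<Sum>i<n. if i = n - a - 1 then v i else 0) - (\<Sum>i<n. if i = n - a then v i else 0))"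
    unfolding sum_subtractf[symmetric] sum_distrib_left
    by (intro sum.cong) (auto simp: y algebra_simps)
  also have "\<dots> = cis (- \<tau> * \<theta>) * (v (a - 1) - v (Suc (a - 1)))
      - \<gamma> * (v (n - a - 1) - v (Suc (n - a - 1)))"
    using a S by (simp add: Uv algebra_simps)
  also have "\<dots> = cis (- \<tau> * \<theta>) * of_real (path_edge_coeff n j a)
      - \<gamma> * of_real (path_edge_coeff n j (n - a))"
    using a S unfolding v_diff by simp
  also have "\<dots> = of_real (path_edge_coeff n j a) * (cis (- \<tau> * \<theta>) + \<gamma> * (-1) ^ j)"
    using a by (simp add: path_edge_coeff_mirror algebra_simps)
  also have "cis (- \<tau> * \<theta>) + \<gamma> * (-1) ^ j
      = cis (\<phi> - 2 * \<tau>) * (cis (\<tau> * (2 * cos (pi * real j / real n)) - \<phi>) - (-1) ^ j)"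
    by (simp add: \<gamma>_def \<theta>_def right_diff_distrib cis_mult algebra_simps)
  finally show ?thesis by (simp add: norm_mult v_def)
qed

lemma path_vec_inversion:
  fixes y :: "nat \<Rightarrow> complex"
  assumes "l < n"
  shows "of_nat n * y l
    = (\<Sum>j<2 * n. of_real (path_eigvec n j l) * (\<Sum>i<n. of_real (path_eigvec n j i) * y i))"
proof -
  have "(\<Sum>j<2 * n. of_real (path_eigvec n j l) * (\<Sum>i<n. of_real (path_eigvec n j i) * y i))
      = (\<Sum>i<n. of_real (\<Sum>j<2 * n. path_eigvec n j l * path_eigvec n j i) * y i)"
    unfolding sum_distrib_left of_real_sum sum_distrib_right
    by (subst sum.swap) (simp add: mult.assoc)
  also have "\<dots> = (\<Sum>i<n. if i = l then of_nat n * y i else 0)"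
    using assms by (intro sum.cong) (auto simp: path_eigvec_completeness)
  finally show ?thesis using assms by simp
qed

text \<open>Both quantities control each other: eigenvector entries are at most 1 in modulus, so a
  spectral coefficient is at most \<open>n\<close> times the norm, and by the inversion formula the
  norm is at most the sum of the \<open>2 * n\<close> coefficients.\<close>

lemma edge_LPGST_path_iff:
  assumes a: "1 \<le> a" "a < n"
  shows "edge_LPGST n (path_edges n) a (a + 1) (n - a) (n - a + 1) \<longleftrightarrow>
    (\<forall>\<epsilon>>0. \<exists>\<tau> \<phi>. \<forall>j<2 * n. \<bar>path_edge_coeff n j a\<bar> *
       cmod (cis (\<tau> * (2 * cos (pi * real j / real n)) - \<phi>) - (-1) ^ j) < \<epsilon>)"
    (is "_ \<longleftrightarrow> (\<forall>\<epsilon>>0. \<exists>\<tau> \<phi>. \<forall>j<2 * n. ?c \<tau> \<phi> j < \<epsilon>)")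
proof -
  define y where "y \<tau> \<gamma> = transition_mat n (path_edges n) \<tau> *\<^sub>v (vertex_vec n a - vertex_vec n (a + 1))
      - \<gamma> \<cdot>\<^sub>v (vertex_vec n (n - a) - vertex_vec n (n - a + 1))" for \<tau> \<gamma>
  have dim: "dim_vec (y \<tau> \<gamma>) = n" for \<tau> \<gamma> by (simp add: y_def vertex_vec_def)
  have edges: "{a, a + 1} \<in> path_edges n" "{n - a, n - a + 1} \<in> path_edges n"
    using a by (force simp: path_edges_def)+
  have c: "cmod (\<Sum>i<n. of_real (path_eigvec n j i) * y \<tau> (- cis (\<phi> - 2 * \<tau>)) $ i) = ?c \<tau> \<phi> j" for \<tau> \<phi> j
    unfolding y_def by (rule path_edge_transfer_spectral[OF a])
  have upper: "?c \<tau> \<phi> j \<le> real n * euclidean_norm (y \<tau> (- cis (\<phi> - 2 * \<tau>)))" for \<tau> \<phi> j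
  proof -
    let ?y = "y \<tau> (- cis (\<phi> - 2 * \<tau>))"
    have "?c \<tau> \<phi> j \<le> (\<Sum>i<n. cmod (of_real (path_eigvec n j i) * ?y $ i))"
      unfolding c[symmetric] by (rule norm_sum)
    also have "\<dots> \<le> (\<Sum>i<n. euclidean_norm ?y)"
    proof (rule sum_mono)
      fix i assume "i \<in> {..<n}"
      then have "cmod (?y $ i) \<le> euclidean_norm ?y"
        unfolding euclidean_norm_def dim by (intro member_le_L2_set) auto
      moreover have "\<bar>path_eigvec n j i\<bar> \<le> 1" by (simp add: path_eigvec_def)
      ultimately show "cmod (of_real (path_eigvec n j i) * ?y $ i) \<le> euclidean_norm ?y"
        using mult_mono[of "\<bar>path_eigvec n j i\<bar>" 1 "cmod (?y $ i)"] by (simp add: norm_mult)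
    qed
    finally show ?thesis by simp
  qed
  have lower: "euclidean_norm (y \<tau> (- cis (\<phi> - 2 * \<tau>))) \<le> (\<Sum>j<2 * n. ?c \<tau> \<phi> j)" for \<tau> \<phi>
  proof -
    let ?y = "y \<tau> (- cis (\<phi> - 2 * \<tau>))"
    have "real n * cmod (?y $ i) \<le> (\<Sum>j<2 * n. ?c \<tau> \<phi> j)" if "i < n" for i
    proof -
      have "real n * cmod (?y $ i) = cmod (of_nat n * ?y $ i)" by (simp add: norm_mult)
      also have "\<dots> \<le> (\<Sum>j<2 * n. cmod (of_real (path_eigvec n j i) *
          (\<Sum>l<n. of_real (path_eigvec n j l) * ?y $ l)))"
        unfolding path_vec_inversion[OF that, of "\<lambda>i. ?y $ i"] by (rule norm_sum)
      also have "\<dots> \<le> (\<Sum>j<2 * n. ?c \<tau> \<phi> j)"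
      proof (rule sum_mono)
        fix j
        have "\<bar>path_eigvec n j i\<bar> \<le> 1" by (simp add: path_eigvec_def)
        then show "cmod (of_real (path_eigvec n j i) *
            (\<Sum>l<n. of_real (path_eigvec n j l) * ?y $ l)) \<le> ?c \<tau> \<phi> j"
          unfolding norm_mult c by (simp add: mult_left_le_one_le)
      qed
      finally show ?thesis .
    qed
    then have "(\<Sum>i<n. real n * cmod (?y $ i)) \<le> (\<Sum>i<n. \<Sum>j<2 * n. ?c \<tau> \<phi> j)"
      by (intro sum_mono) auto
    then have "real n * (\<Sum>i<n. cmod (?y $ i)) \<le> real n * (\<Sum>j<2 * n. ?c \<tau> \<phi> j)"
      by (simp only: sum_distrib_left[symmetric]) simp
    moreover have "euclidean_norm ?y \<le> (\<Sum>i<n. cmod (?y $ i))"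
      unfolding euclidean_norm_def dim by (rule L2_set_le_sum) auto
    ultimately show ?thesis using a by simp
  qed
  show ?thesis
  proof
    assume lhs: "edge_LPGST n (path_edges n) a (a + 1) (n - a) (n - a + 1)"
    show "\<forall>\<epsilon>>0. \<exists>\<tau> \<phi>. \<forall>j<2 * n. ?c \<tau> \<phi> j < \<epsilon>"
    proof (intro allI impI)
      fix \<epsilon> :: real assume "\<epsilon> > 0"
      then have "\<epsilon> / real n > 0" using a by simp
      then obtain \<tau> \<gamma> where \<gamma>: "cmod \<gamma> = 1" "euclidean_norm (y \<tau> \<gamma>) < \<epsilon> / real n"
        using lhs unfolding edge_LPGST_def y_def by blast
      \<comment> \<open>Every \<open>\<gamma>\<close> of modulus one arises from the parametrisation
        with this angle.\<close>
      define \<phi> where "\<phi> = Arg (- \<gamma>) + 2 * \<tau>"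
      have "\<gamma> = - cis (\<phi> - 2 * \<tau>)"
      proof -
        have "- \<gamma> \<noteq> 0" using \<gamma>(1) by auto
        then have "cis (Arg (- \<gamma>)) = - \<gamma>" using cis_Arg[of "- \<gamma>"] \<gamma>(1) by (simp add: sgn_div_norm)
        then show ?thesis by (simp add: \<phi>_def)
      qed
      then have "?c \<tau> \<phi> j < \<epsilon>" for j
        using upper[where \<tau> = \<tau> and \<phi> = \<phi> and j = j] \<gamma>(2) a by (simp add: field_simps)
      then show "\<exists>\<tau> \<phi>. \<forall>j<2 * n. ?c \<tau> \<phi> j < \<epsilon>" by blast
    qed
  next
    assume rhs: "\<forall>\<epsilon>>0. \<exists>\<tau> \<phi>. \<forall>j<2 * n. ?c \<tau> \<phi> j < \<epsilon>"
    have "\<exists>\<tau> \<gamma>. cmod \<gamma> = 1 \<and> euclidean_norm (y \<tau> \<gamma>) < \<epsilon>" if "\<epsilon> > 0" for \<epsilon>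
    proof -
      have "\<epsilon> / real (2 * n) > 0" using a that by simp
      then obtain \<tau> \<phi> where "\<forall>j<2 * n. ?c \<tau> \<phi> j < \<epsilon> / real (2 * n)" using rhs by blast
      then have "(\<Sum>j<2 * n. ?c \<tau> \<phi> j) < (\<Sum>j<2 * n. \<epsilon> / real (2 * n))"
        using a by (intro sum_strict_mono) (auto simp: lessThan_empty_iff)
      also have "\<dots> = \<epsilon>" using a by simp
      finally have "euclidean_norm (y \<tau> (- cis (\<phi> - 2 * \<tau>))) < \<epsilon>" using lower[where \<tau> = \<tau> and \<phi> = \<phi>] by simp
      moreover have "cmod (- cis (\<phi> - 2 * \<tau>)) = 1" by simp
      ultimately show ?thesis by blast
    qed
    then show "edge_LPGST n (path_edges n) a (a + 1) (n - a) (n - a + 1)"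
      unfolding edge_LPGST_def y_def using edges by blast
  qed
qed

section \<open>Constrained indices and the two implications\<close>

lemma path_edge_coeff_eq_0_iff:
  assumes "0 < j" "j < 2 * n"
  shows "path_edge_coeff n j a = 0 \<longleftrightarrow> n dvd j * a"
proof -
  have "sin (pi * real j / (2 * real n)) > 0"
    using assms by (intro sin_gt_zero) (simp_all add: field_simps)
  moreover have "sin (pi * real j * real a / real n) = 0 \<longleftrightarrow> n dvd j * a"
  proof -
    have "sin (pi * real j * real a / real n) = 0 \<longleftrightarrow> (\<exists>m::int. pi * real j * real a / real n = of_int m * pi)"
      by (rule sin_zero_iff_int2)
    also have "\<dots> \<longleftrightarrow> (\<exists>m::int. real_of_int (int (j * a)) = real_of_int (m * int n))"
      using assms by (simp add: field_simps)
    also have "\<dots> \<longleftrightarrow> int n dvd int (j * a)"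
      unfolding of_int_eq_iff by (auto simp: dvd_def mult.commute)
    finally show ?thesis by (simp only: int_dvd_int_iff)
  qed
  ultimately show ?thesis by (simp add: path_edge_coeff_def)
qed

text \<open>The choice \<open>\<phi> = pi\<close> turns the signs of \<open>path_sign\<close> into
  \<open>(-1) ^ j\<close>. They disagree only at multiples of \<open>2 * p\<close>, where
  \<open>n\<close> divides \<open>j * a\<close> and the coefficient vanishes.\<close>

lemma path_transfer_sufficient:
  assumes t: "t \<ge> 1" and p: "prime p" "odd p" and n: "n = 2 ^ t * p"
    and a: "1 \<le> a" "a < n" and dvd: "2 ^ (t - 1) dvd a"
  shows "edge_LPGST n (path_edges n) a (a + 1) (n - a) (n - a + 1)"
  unfolding edge_LPGST_path_iff[OF a]
proof (intro allI impI)
  fix \<epsilon> :: real assume \<epsilon>: "\<epsilon> > 0"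
  obtain \<tau> :: "nat \<Rightarrow> real" where
    \<tau>: "\<And>j::int. (\<lambda>k. cis (\<tau> k * (2 * cos (pi * real_of_int j / real n)))) \<longlonglongrightarrow> of_real (path_sign p j)"
    using path_phases[OF t p n] by blast
  have "(\<lambda>k. \<bar>path_edge_coeff n j a\<bar> * cmod (cis (\<tau> k * (2 * cos (pi * real j / real n)) - pi) - (-1) ^ j)) \<longlonglongrightarrow> 0"
    if j: "j < 2 * n" for j
  proof (cases "path_edge_coeff n j a = 0")
    case False
    then have "j > 0" by (intro Nat.gr0I) (simp add: path_edge_coeff_def)
    then have ndvd: "\<not> n dvd j * a" using False j path_edge_coeff_eq_0_iff by blast
    have "\<not> (even j \<and> p dvd j)"
    proof
      assume "even j \<and> p dvd j"
      moreover have "coprime 2 p" using p by simp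
      ultimately have "2 * p dvd j" by (simp add: divides_mult)
      then have "(2 * p) * 2 ^ (t - 1) dvd j * a" using dvd by (rule mult_dvd_mono)
      moreover have "(2 * p) * 2 ^ (t - 1) = n" using t by (simp add: n power_eq_if)
      ultimately show False using ndvd by simp
    qed
    then have s: "path_sign p (int j) = - ((-1) ^ j)" by (auto simp: path_sign_def)
    have "(\<lambda>k. - cis (\<tau> k * (2 * cos (pi * real j / real n))) - (-1) ^ j) \<longlonglongrightarrow> - of_real (path_sign p (int j)) - (-1) ^ j"
      using \<tau>[of "int j"] by (intro tendsto_intros) simp
    also have "- of_real (path_sign p (int j)) - (-1) ^ j = (0 :: complex)" by (simp add: s)
    finally have "(\<lambda>k. \<bar>path_edge_coeff n j a\<bar> * cmod (- cis (\<tau> k * (2 * cos (pi * real j / real n))) - (-1) ^ j)) \<longlonglongrightarrow> 0"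
      by (intro tendsto_mult_right_zero tendsto_norm_zero)
    then show ?thesis by (simp flip: cis_divide)
  qed simp
  then have "\<forall>\<^sub>F k in sequentially. \<forall>j\<in>{..<2 * n}. \<bar>path_edge_coeff n j a\<bar> *
      cmod (cis (\<tau> k * (2 * cos (pi * real j / real n)) - pi) - (-1) ^ j) < \<epsilon>"
    using \<epsilon> by (intro eventually_ball_finite ballI order_tendstoD(2)[where y = 0]) auto
  then show "\<exists>\<tau> \<phi>. \<forall>j<2 * n. \<bar>path_edge_coeff n j a\<bar> *
      cmod (cis (\<tau> * (2 * cos (pi * real j / real n)) - \<phi>) - (-1) ^ j) < \<epsilon>"
    by (auto simp: eventually_sequentially)
qed

lemma path_transfer_necessary:
  assumes t: "t \<ge> 1" and p: "prime p" "odd p" and n: "n = 2 ^ t * p"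
    and a: "1 \<le> a" "a < n"
    and transfer: "edge_LPGST n (path_edges n) a (a + 1) (n - a) (n - a + 1)"
  shows "2 ^ (t - 1) dvd a"
proof (rule ccontr)
  assume ndvd: "\<not> 2 ^ (t - 1) dvd a"
  have p1: "p > 1" using p prime_gt_1_nat by blast
  have pow_t: "(2::nat) ^ t = 2 * 2 ^ (t - 1)" using t by (cases t) simp_all
  \<comment> \<open>For \<open>t = 1\<close> the divisor is 1. From here on 4 divides
    \<open>2 ^ t\<close>.\<close>
  have t2: "t \<ge> 2" using ndvd t by (cases "t = 1") auto
  have "\<exists>\<tau> \<phi>. \<forall>j<2 * n. \<bar>path_edge_coeff n j a\<bar> *
      cmod (cis (\<tau> * (2 * cos (pi * real j / real n)) - \<phi>) - (-1) ^ j) < 1 / real (Suc k)" for k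
    using transfer unfolding edge_LPGST_path_iff[OF a] by simp
  then obtain \<tau> \<phi> :: "nat \<Rightarrow> real" where bound: "\<And>k j. j < 2 * n \<Longrightarrow> \<bar>path_edge_coeff n j a\<bar> *
      cmod (cis (\<tau> k * (2 * cos (pi * real j / real n)) - \<phi> k) - (-1) ^ j) < 1 / real (Suc k)"
    by metis
  have lim: "(\<lambda>k. cis (\<tau> k * (2 * cos (pi * real j / real n)) - \<phi> k)) \<longlonglongrightarrow> of_real ((-1) ^ j)"
    if j: "j < 2 * n" "\<not> 4 dvd j" for j
  proof -
    have "j > 0" using j by (intro Nat.gr0I) auto
    have "\<not> n dvd j * a"
    proof
      assume "n dvd j * a"
      then have dvd: "2 ^ t dvd j * a" unfolding n by (rule dvd_mult_left)
      have "2 ^ (t - 1) dvd a"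
      proof (cases "even j")
        case True
        then obtain i where i: "j = 2 * i" by (elim evenE)
        have "odd i"
        proof
          assume "even i"
          then have "2 * 2 dvd 2 * i" by (intro mult_dvd_mono) simp_all
          then show False using j i by simp
        qed
        \<comment> \<open>Since 4 does not divide \<open>j\<close>, only one factor 2 comes from
          \<open>j\<close>; the remaining ones must come from \<open>a\<close>.\<close>
        have "2 * 2 ^ (t - 1) dvd 2 * (i * a)" using dvd by (simp only: i pow_t mult.assoc)
        then have "2 ^ (t - 1) dvd i * a" by (simp only: nat_mult_dvd_cancel_disj) simp
        then show ?thesis using \<open>odd i\<close> by (simp add: coprime_dvd_mult_right_iff)
      next
        case False
        then have "2 ^ t dvd a" using dvd by (simp add: coprime_dvd_mult_right_iff)
        then show ?thesis by (meson diff_le_self le_imp_power_dvd dvd_trans)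
      qed
      then show False using ndvd by simp
    qed
    then have nz: "path_edge_coeff n j a \<noteq> 0" using path_edge_coeff_eq_0_iff \<open>j > 0\<close> j by blast
    have "(\<lambda>k. \<bar>path_edge_coeff n j a\<bar> *
        cmod (cis (\<tau> k * (2 * cos (pi * real j / real n)) - \<phi> k) - (-1) ^ j)) \<longlonglongrightarrow> 0"
      by (rule Lim_null_comparison[OF _ lim_1_over_n[THEN LIMSEQ_Suc]])
        (use bound[OF j(1)] in \<open>auto intro!: always_eventually less_imp_le simp: abs_mult\<close>)
    then have "(\<lambda>k. cmod (cis (\<tau> k * (2 * cos (pi * real j / real n)) - \<phi> k) - (-1) ^ j)) \<longlonglongrightarrow> 0"
      using nz by (simp add: tendsto_mult_left_iff[of "\<bar>path_edge_coeff n j a\<bar>" _ 0, simplified])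
    then show ?thesis by (simp add: tendsto_norm_zero_iff LIM_zero_iff)
  qed
  \<comment> \<open>Adding multiples of \<open>2 ^ t\<close> preserves \<open>j\<close> modulo 4, so
    every index of the relation is constrained. In the alternating sum the cosines cancel and
    \<open>\<phi>\<close> survives exactly once, as \<open>p\<close> is odd; the limit signs are all
    \<open>(-1) ^ j\<close>, an odd number of times.\<close>
  have *: "(\<lambda>k. cis (- \<phi> k)) \<longlonglongrightarrow> of_real ((-1) ^ j)" if j: "0 < j" "j < 4" for j :: nat
  proof -
    obtain q where q: "2 ^ t = 4 * (q :: nat)"
      using le_imp_power_dvd[OF t2, of "2 :: nat"] by (auto elim: dvdE)
    have "(\<lambda>k. cis (\<Sum>m<p. (-1) ^ m * (\<tau> k * (2 * cos (pi * real (j + 2 ^ t * m) / real n)) - \<phi> k)))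
        \<longlonglongrightarrow> of_real (\<Prod>m<p. (-1) ^ (j + 2 ^ t * m))"
    proof (rule tendsto_cis_signed_sum)
      fix m assume m: "m \<in> {..<p}"
      have "j + 2 ^ t * m < 2 * n"
      proof -
        have "2 ^ t * m + 2 ^ t \<le> n" using m mult_le_mono2[of "Suc m" p "2 ^ t"] by (simp add: n)
        moreover have "(2::nat) ^ t > 0" by simp
        then have "4 \<le> (2::nat) ^ t" unfolding q by simp
        ultimately show ?thesis using j by linarith
      qed
      moreover have "\<not> 4 dvd j + 2 ^ t * m"
        using j by (simp add: q mult.assoc dvd_add_left_iff nat_dvd_not_less)
      ultimately show "(\<lambda>k. cis (\<tau> k * (2 * cos (pi * real (j + 2 ^ t * m) / real n)) - \<phi> k))
          \<longlonglongrightarrow> of_real ((-1) ^ (j + 2 ^ t * m))"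
        by (rule lim)
      show "(-1) ^ m \<in> {1, - 1 :: real}" by (cases "even m") auto
    qed
    moreover have "(\<Sum>m<p. (-1) ^ m * (\<tau> k * (2 * cos (pi * real (j + 2 ^ t * m) / real n)) - \<phi> k)) = - \<phi> k" for k
    proof -
      have "(\<Sum>m<p. (-1) ^ m * (\<tau> k * (2 * cos (pi * real (j + 2 ^ t * m) / real n)) - \<phi> k))
        = 2 * \<tau> k * (\<Sum>m<p. (-1) ^ m * cos (pi * (real j + real (2 ^ t * m)) / real (2 ^ t * p)))
          - \<phi> k * (\<Sum>m<p. (-1) ^ m)"
        by (simp add: n sum_distrib_left sum_subtractf algebra_simps)
      also have "(\<Sum>m<p. (-1) ^ m :: real) = 1" using p by (simp add: sum_gp_strict)
      finally show ?thesis using alternating_cos_sum[of p "2 ^ t" "real j"] p p1 by simp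
    qed
    moreover have "(\<Prod>m<p. (-1) ^ (j + 2 ^ t * m)) = ((-1) ^ j :: real)"
    proof -
      have "(-1) ^ (j + 2 ^ t * m) = ((-1) ^ j :: real)" for m
        using t by (simp add: power_add uminus_power_if)
      then show ?thesis using p by (simp flip: power_mult add: uminus_power_if)
    qed
    ultimately show ?thesis by simp
  qed
  \<comment> \<open>The same sequence would tend to -1 for \<open>j = 1\<close> and to 1 for
    \<open>j = 2\<close>.\<close>
  show False using LIMSEQ_unique[OF *[of 1] *[of 2]] by simp
qed

theorem theorem3p6:
  fixes n t p a :: nat
  assumes "t \<ge> 1" and "prime p" and "odd p" and "n = 2 ^ t * p"
    and "1 \<le> a" and "a \<le> n - 1"
  shows "edge_LPGST n (path_edges n) a (a + 1) (n - a) (n - a + 1) \<longleftrightarrow> 2 ^ (t - 1) dvd a"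
proof -
  have "a < n" using assms(5,6) by linarith
  then show ?thesis
    using path_transfer_sufficient[OF assms(1-5)] path_transfer_necessary[OF assms(1-5)] by blast
qed

end
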